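(* There exist a sequence of finite abelian groups $G_n$ and subsets $E_n\subseteq G_n$ such that $\rho(E_n)\to\infty$ as $n\to\infty$.
   Context: Let $G$ be a finite abelian group with dual group $\widehat G$ (characters $G\to\mathbb{S}^1$). For nonempty $E=\{x_1,\dots,x_n\}\subseteq G$ and $B=\{b_1,\dots,b_n\}\subseteq\widehat G$ of the same size, let $T(E,B)$ be the $n\times n$ matrix with $(i,j)$ entry $b_j(x_i)$, and let $\rho_E(B)=\operatorname{cond}(T(E,B))^2=\|T\|^2\|T^{-1}\|^2$ (operator $2$-norm), defined to be $\infty$ if $T(E,B)$ is singular. The Riesz ratio of $E$ is $\rho(E)=\min\{\rho_E(B): B\subseteq\widehat G,\ |B|=|E|\}$. *)

theory Defs
  imports
    "HOL-Algebra.Group"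
    "HOL-Library.Extended_Real"
    "HOL-Analysis.L2_Norm"
    "Jordan_Normal_Form.Gauss_Jordan_Elimination"
begin

definition circle_group :: "complex monoid" where
  "circle_group = \<lparr>carrier = {z. cmod z = 1}, monoid.mult = (*), one = 1\<rparr>"

text \<open>
  Homomorphisms are unconstrained outside the carrier; intersecting with
  \<^const>\<open>extensional\<close> makes distinct elements distinct characters.
\<close>

definition characters :: "('a, 'm) monoid_scheme \<Rightarrow> ('a \<Rightarrow> complex) set" where
  "characters G = hom G circle_group \<inter> extensional (carrier G)"

definition vec_norm2 :: "complex vec \<Rightarrow> real" where
  "vec_norm2 v = L2_set (\<lambda>i. cmod (v $ i)) {..<dim_vec v}"

definition mat_opnorm2 :: "complex mat \<Rightarrow> real" where
  "mat_opnorm2 A =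
     Sup {vec_norm2 (A *\<^sub>v v) | v. v \<in> carrier_vec (dim_col A) \<and> vec_norm2 v \<le> 1}"

definition mat_cond2 :: "complex mat \<Rightarrow> ereal" where
  "mat_cond2 A = (case mat_inverse A of
       None \<Rightarrow> \<infinity>
     | Some A' \<Rightarrow> ereal (mat_opnorm2 A * mat_opnorm2 A'))"

definition enumeration :: "'a set \<Rightarrow> 'a list" where
  "enumeration S = (SOME xs. distinct xs \<and> set xs = S)"

text \<open>
  Other enumerations of \<open>E\<close> and \<open>B\<close> permute the rows and columns of this matrix,
  which changes neither its invertibility nor its condition number.
\<close>

definition char_matrix :: "'a set \<Rightarrow> ('a \<Rightarrow> complex) set \<Rightarrow> complex mat" where
  "char_matrix E B =
     mat (card E) (card B) (\<lambda>(i, j). (enumeration B ! j) (enumeration E ! i))"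

definition riesz_ratio_wrt :: "'a set \<Rightarrow> ('a \<Rightarrow> complex) set \<Rightarrow> ereal" where
  "riesz_ratio_wrt E B = (mat_cond2 (char_matrix E B))\<^sup>2"

definition riesz_ratio :: "('a, 'm) monoid_scheme \<Rightarrow> 'a set \<Rightarrow> ereal" where
  "riesz_ratio G E = Min (riesz_ratio_wrt E ` {B. B \<subseteq> characters G \<and> card B = card E})"

end

theory Submission
  imports Defs "HOL-Algebra.Elementary_Groups"
begin

text \<open>
  In \<open>\<int>/2q\<close> let \<open>E\<close> be the subgroup of even residues together with the residue 1. That subgroup
  has only \<open>q\<close> characters, so any \<open>q + 1\<close> characters of \<open>\<int>/2q\<close> include two, \<open>b \<noteq> c\<close>, which
  agree on \<open>E - {1}\<close>. The matrix \<open>T\<close> then maps the difference of the corresponding basis vectors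
  to a vector supported in one coordinate, of modulus at most 2, so that \<open>\<parallel>T\<^sup>-\<^sup>1\<parallel> \<ge> 1/2\<close>. As the
  columns of \<open>T\<close> have norm \<open>sqrt (q + 1)\<close>, the Riesz ratio is at least \<open>(q + 1)/4\<close>.
\<close>

section \<open>Operator norm and condition number\<close>

lemma cmod_index_le_vec_norm2:
  "i < dim_vec v \<Longrightarrow> cmod (v $ i) \<le> vec_norm2 v"
  unfolding vec_norm2_def by (rule member_le_L2_set) auto

lemma vec_norm2_smult: "vec_norm2 (c \<cdot>\<^sub>v v) = cmod c * vec_norm2 v"
  by (simp add: vec_norm2_def L2_set_right_distrib norm_mult cong: L2_set_cong_simp)

lemma vec_norm2_unit_vec:
  assumes "j < n"
  shows "vec_norm2 (unit_vec n j) = 1"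
proof -
  have "vec_norm2 (unit_vec n j) = sqrt (\<Sum>i<n. if i = j then 1 else 0)"
    unfolding vec_norm2_def L2_set_def
    by (rule arg_cong[where f = sqrt], rule sum.cong) (use assms in \<open>auto simp: unit_vec_def\<close>)
  with assms show ?thesis by simp
qed

lemma mult_mat_unit_vec:
  fixes A :: "'a :: semiring_1 mat"
  assumes "A \<in> carrier_mat m n" and "j < n"
  shows "A *\<^sub>v unit_vec n j = col A j"
  by (rule eq_vecI) (use assms in auto)

text \<open>A real \<open>Sup\<close> is sure to dominate its members only if the set is bounded
  above. Coordinates of a vector in the unit ball have modulus at most 1, so the sum of the moduli
  of all entries of \<open>A\<close> is such a bound.\<close>

lemma vec_norm2_mult_mat_vec_le_mat_opnorm2:
  assumes v: "v \<in> carrier_vec (dim_col A)" "vec_norm2 v \<le> 1"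
  shows "vec_norm2 (A *\<^sub>v v) \<le> mat_opnorm2 A"
proof -
  have "vec_norm2 (A *\<^sub>v u) \<le> (\<Sum>i<dim_row A. \<Sum>j<dim_col A. cmod (A $$ (i, j)))"
    if u: "u \<in> carrier_vec (dim_col A)" "vec_norm2 u \<le> 1" for u
  proof -
    have "vec_norm2 (A *\<^sub>v u) \<le> (\<Sum>i<dim_row A. cmod ((A *\<^sub>v u) $ i))"
      unfolding vec_norm2_def by (rule order_trans[OF L2_set_le_sum]) auto
    also have "\<dots> \<le> (\<Sum>i<dim_row A. \<Sum>j<dim_col A. cmod (A $$ (i, j)))"
    proof (rule sum_mono)
      fix i assume i: "i \<in> {..<dim_row A}"
      have "(A *\<^sub>v u) $ i = (\<Sum>j<dim_col A. A $$ (i, j) * u $ j)"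
        using i u by (simp add: scalar_prod_def atLeast0LessThan)
      also have "cmod \<dots> \<le> (\<Sum>j<dim_col A. cmod (A $$ (i, j)) * cmod (u $ j))"
        by (rule order_trans[OF norm_sum]) (simp add: norm_mult)
      also have "\<dots> \<le> (\<Sum>j<dim_col A. cmod (A $$ (i, j)) * 1)"
      proof (intro sum_mono mult_left_mono)
        fix j assume "j \<in> {..<dim_col A}"
        then show "cmod (u $ j) \<le> 1"
          using cmod_index_le_vec_norm2[of j u] u by simp
      qed simp
      finally show "cmod ((A *\<^sub>v u) $ i) \<le> (\<Sum>j<dim_col A. cmod (A $$ (i, j)))" by simp
    qed
    finally show ?thesis .
  qed
  then have "bdd_above {vec_norm2 (A *\<^sub>v v) | v. v \<in> carrier_vec (dim_col A) \<and> vec_norm2 v \<le> 1}"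
    by (intro bdd_aboveI) auto
  with v show ?thesis
    unfolding mat_opnorm2_def by (intro cSup_upper) auto
qed

text \<open>The vector \<open>u\<close> bounds the norm of \<open>A\<close> from below. An inverse
  takes \<open>A *\<^sub>v w\<close> back to \<open>w\<close>, so its norm is at least that of
  \<open>w\<close> divided by \<open>s\<close>. A singular matrix has condition number
  \<infinity>.\<close>

lemma mat_cond2_ge:
  assumes A: "A \<in> carrier_mat n n"
    and u: "u \<in> carrier_vec n" "vec_norm2 u \<le> 1"
    and w: "w \<in> carrier_vec n" "vec_norm2 (A *\<^sub>v w) \<le> s"
    and s: "s > 0"
  shows "ereal (vec_norm2 (A *\<^sub>v u) * (vec_norm2 w / s)) \<le> mat_cond2 A"
proof (cases "mat_inverse A")
  case None
  then show ?thesis by (simp add: mat_cond2_def)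
next
  case (Some A')
  then have A': "A' * A = 1\<^sub>m n" "A' \<in> carrier_mat n n"
    using mat_inverse(2)[OF A] by auto
  \<comment> \<open>Scaling by \<open>1 / s\<close> moves \<open>A *\<^sub>v w\<close> into the unit
    ball, over which the operator norm is a supremum.\<close>
  define v where "v = complex_of_real (1 / s) \<cdot>\<^sub>v (A *\<^sub>v w)"
  have v: "v \<in> carrier_vec n" "vec_norm2 v \<le> 1"
    using A w s by (auto simp: v_def vec_norm2_smult norm_divide field_simps simp del: of_real_divide)
  have "A' *\<^sub>v v = complex_of_real (1 / s) \<cdot>\<^sub>v ((A' * A) *\<^sub>v w)"
    unfolding v_def assoc_mult_mat_vec[OF A'(2) A w(1)]
    by (rule mult_mat_vec[OF A'(2)]) (use A w in simp)
  then have "vec_norm2 (A' *\<^sub>v v) = vec_norm2 w / s"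
    using w s by (simp add: A' vec_norm2_smult norm_divide)
  moreover have "vec_norm2 (A' *\<^sub>v v) \<le> mat_opnorm2 A'"
    using v A' by (intro vec_norm2_mult_mat_vec_le_mat_opnorm2) auto
  ultimately have inv: "vec_norm2 w / s \<le> mat_opnorm2 A'" by simp
  have dir: "vec_norm2 (A *\<^sub>v u) \<le> mat_opnorm2 A"
    using u A by (intro vec_norm2_mult_mat_vec_le_mat_opnorm2) auto
  have nonneg: "0 \<le> vec_norm2 (A *\<^sub>v u)" "0 \<le> vec_norm2 w / s"
    using s by (auto simp: vec_norm2_def)
  have "vec_norm2 (A *\<^sub>v u) * (vec_norm2 w / s) \<le> mat_opnorm2 A * mat_opnorm2 A'"
    using inv dir nonneg by (intro mult_mono) auto
  with Some show ?thesis by (simp add: mat_cond2_def)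
qed

section \<open>Characters that agree off one point\<close>

lemma enumeration:
  assumes "finite S"
  shows "distinct (enumeration S)" "set (enumeration S) = S" "length (enumeration S) = card S"
proof -
  have "\<exists>xs. distinct xs \<and> set xs = S"
    using finite_distinct_list[OF assms] by blast
  then have "distinct (enumeration S) \<and> set (enumeration S) = S"
    unfolding enumeration_def by (rule someI_ex)
  then show "distinct (enumeration S)" "set (enumeration S) = S" "length (enumeration S) = card S"
    using distinct_card by force+
qed

text \<open>The difference \<open>w\<close> of the unit vectors at the positions of \<open>b\<close>
  and \<open>c\<close> is sent to a difference of columns, which vanishes in every row except
  possibly that of \<open>y\<close>. The condition number is therefore at least
  \<open>sqrt n / 2\<close>.\<close>

lemma riesz_ratio_wrt_ge:
  assumes E: "finite E" and B: "finite B" and card: "card B = card E"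
    and unimodular: "\<And>b x. b \<in> B \<Longrightarrow> x \<in> E \<Longrightarrow> cmod (b x) = 1"
    and bc: "b \<in> B" "c \<in> B" "b \<noteq> c" "\<And>x. x \<in> E - {y} \<Longrightarrow> b x = c x"
  shows "ereal (card E / 4) \<le> riesz_ratio_wrt E B"
proof -
  define n where "n = card E"
  define A where "A = char_matrix E B"
  let ?e = "enumeration E" and ?b = "enumeration B"
  have A: "A \<in> carrier_mat n n"
    by (simp add: A_def char_matrix_def n_def card)
  have entry: "A $$ (i, j) = (?b ! j) (?e ! i)" if "i < n" "j < n" for i j
    using that by (simp add: A_def char_matrix_def n_def card)
  have e_in: "?e ! i \<in> E" if "i < n" for i
    using that enumeration[OF E] by (metis n_def nth_mem)
  obtain j k where jk: "j < n" "k < n" "?b ! j = b" "?b ! k = c"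
    using bc enumeration[OF B] card by (metis in_set_conv_nth n_def)
  then have "j \<noteq> k" using bc by auto
  define w where "w = unit_vec n j - (unit_vec n k :: complex vec)"
  have w: "w \<in> carrier_vec n" by (simp add: w_def)
  have "A *\<^sub>v w = col A j - col A k"
    using A jk by (simp add: w_def mult_minus_distrib_mat_vec mult_mat_unit_vec[OF A])
  then have Aw: "(A *\<^sub>v w) $ i = b (?e ! i) - c (?e ! i)" if "i < n" for i
    using that A jk by (simp add: entry)
  have "vec_norm2 (A *\<^sub>v w) \<le> (\<Sum>i<n. cmod ((A *\<^sub>v w) $ i))"
    unfolding vec_norm2_def using A by (intro order_trans[OF L2_set_le_sum]) auto
  also have "\<dots> \<le> (\<Sum>i<n. if ?e ! i = y then 2 else 0)"
  proof (rule sum_mono)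
    fix i assume i: "i \<in> {..<n}"
    have "cmod (b (?e ! i) - c (?e ! i)) \<le> 2"
      using norm_triangle_ineq4[of "b (?e ! i)" "c (?e ! i)"] unimodular bc e_in i by simp
    then show "cmod ((A *\<^sub>v w) $ i) \<le> (if ?e ! i = y then 2 else 0)"
      using i Aw e_in bc(4) by auto
  qed
  also have "\<dots> = 2 * real (card {i. i < n \<and> ?e ! i = y})"
    by (simp add: sum.If_cases Int_def)
  also have "\<dots> \<le> 2"
  proof -
    \<comment> \<open>The enumeration is distinct, so at most one row belongs to
      \<open>y\<close>.\<close>
    have "i = i'" if "i < n" "i' < n" "?e ! i = y" "?e ! i' = y" for i i'
      using that enumeration[OF E] by (metis n_def nth_eq_iff_index_eq)
    then have "card {i. i < n \<and> ?e ! i = y} \<le> 1"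
      by (subst card_le_Suc0_iff_eq[unfolded One_nat_def[symmetric]]) auto
    then show ?thesis by simp
  qed
  finally have norm_Aw: "vec_norm2 (A *\<^sub>v w) \<le> 2" .
  \<comment> \<open>One coordinate gives a sufficient lower bound; the exact norm
    \<open>sqrt 2\<close> would only improve the constant.\<close>
  have "cmod (w $ j) = 1"
    using jk \<open>j \<noteq> k\<close> by (simp add: w_def)
  then have norm_w: "1 \<le> vec_norm2 w"
    using cmod_index_le_vec_norm2[of j w] jk w by simp
  have "A *\<^sub>v unit_vec n j = col A j"
    using A jk by (simp add: mult_mat_unit_vec[OF A])
  then have "vec_norm2 (A *\<^sub>v unit_vec n j) = L2_set (\<lambda>i. 1) {..<n}"
    unfolding vec_norm2_def using A jk
    by (intro L2_set_cong) (auto simp: entry unimodular bc e_in)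
  then have norm_col: "vec_norm2 (A *\<^sub>v unit_vec n j) = sqrt n"
    by (simp add: L2_set_constant)
  have "sqrt n * (1 / 2) \<le> vec_norm2 (A *\<^sub>v unit_vec n j) * (vec_norm2 w / 2)"
    unfolding norm_col using norm_w by (intro mult_left_mono) auto
  then have "ereal (sqrt n / 2) \<le> ereal (vec_norm2 (A *\<^sub>v unit_vec n j) * (vec_norm2 w / 2))"
    by simp
  also have "\<dots> \<le> mat_cond2 A"
    using A w jk norm_Aw by (intro mat_cond2_ge[of A n]) (auto simp: vec_norm2_unit_vec)
  finally have "ereal (sqrt n / 2) \<le> mat_cond2 A" .
  \<comment> \<open>Nonnegative sides allow the inequality to be squared.\<close>
  moreover from this have "0 \<le> mat_cond2 A"
    by (rule order_trans[rotated]) simp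
  ultimately have "ereal (sqrt n / 2) * ereal (sqrt n / 2) \<le> mat_cond2 A * mat_cond2 A"
    by (intro ereal_mult_mono) auto
  then show ?thesis
    by (simp add: riesz_ratio_wrt_def A_def[symmetric] n_def[symmetric] power2_eq_square)
qed

section \<open>Characters of the integers modulo \<open>N\<close>\<close>

lemma cmod_character:
  "b \<in> characters G \<Longrightarrow> x \<in> carrier G \<Longrightarrow> cmod (b x) = 1"
  by (auto simp: characters_def hom_def circle_group_def Pi_iff)

lemma character_mult:
  "b \<in> characters G \<Longrightarrow> x \<in> carrier G \<Longrightarrow> y \<in> carrier G \<Longrightarrow> b (x \<otimes>\<^bsub>G\<^esub> y) = b x * b y"
  by (auto simp: characters_def hom_def circle_group_def)

text \<open>The residue 1 generates the group, so its image determines the character;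
  \<open>N \<ge> 2\<close> puts 1 among the representatives.\<close>

lemma character_integer_mod_group_eq_power:
  assumes "b \<in> characters (integer_mod_group N)" and "N \<ge> 2" and "m < N"
  shows "b (int m) = b 1 ^ m"
  using \<open>m < N\<close>
proof (induction m)
  case 0
  \<comment> \<open>A nonzero idempotent complex number is 1.\<close>
  have "b 0 = b 0 * b 0" "b 0 \<noteq> 0"
    using character_mult[OF assms(1), of 0 0] cmod_character[OF assms(1), of 0] by auto
  then show ?case by simp
next
  case (Suc m)
  have "b ((1 + int m) mod int N) = b 1 * b (int m)"
    using character_mult[OF assms(1), of 1 "int m"] Suc.prems
    by (simp add: carrier_integer_mod_group)
  with Suc show ?case by simp
qed

lemma character_integer_mod_group_root_of_unity:
  assumes b: "b \<in> characters (integer_mod_group N)" and N: "N \<ge> 2"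
  shows "b 1 ^ N = 1"
proof -
  \<comment> \<open>The sum wraps around to 0, where the character takes the value 1.\<close>
  have "b ((1 + int (N - 1)) mod int N) = b 1 * b (int (N - 1))"
    using character_mult[OF b, of 1 "int (N - 1)"] N
    by (simp add: carrier_integer_mod_group)
  also have "\<dots> = b 1 ^ N"
    using character_integer_mod_group_eq_power[OF b N, of "N - 1"] N
    by (simp flip: power_Suc)
  finally show ?thesis
    using character_integer_mod_group_eq_power[OF b N, of 0] N by (simp add: of_nat_diff)
qed

text \<open>On the carrier both characters are powers of the same number; off it extensionality
  makes both \<open>undefined\<close>.\<close>

lemma inj_on_characters_integer_mod_group:
  assumes N: "N \<ge> 2"
  shows "inj_on (\<lambda>b. b 1) (characters (integer_mod_group N))"
proof (rule inj_onI)
  fix b c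
  assume b: "b \<in> characters (integer_mod_group N)" and c: "c \<in> characters (integer_mod_group N)"
    and eq: "b 1 = c 1"
  show "b = c"
  proof (rule extensionalityI[where A = "{0..<int N}"])
    show "b \<in> extensional {0..<int N}" "c \<in> extensional {0..<int N}"
      using b c N by (auto simp: characters_def carrier_integer_mod_group)
    fix x assume "x \<in> {0..<int N}"
    then obtain m where "x = int m" "m < N"
      by (metis atLeastLessThan_iff nat_less_iff int_nat_eq)
    then show "b x = c x"
      using character_integer_mod_group_eq_power[OF b N] character_integer_mod_group_eq_power[OF c N]
      by (simp add: eq)
  qed
qed

text \<open>A root of unity \<open>z\<close> comes from the character sending \<open>x\<close> to
  \<open>z ^ nat x\<close>, which is multiplicative because exponents of \<open>z\<close> matter
  only modulo \<open>N\<close>.\<close>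

lemma characters_integer_mod_group_image:
  assumes N: "N \<ge> 2"
  shows "(\<lambda>b. b 1) ` characters (integer_mod_group N) = {z. z ^ N = 1}"
proof (intro equalityI subsetI)
  fix z :: complex assume z: "z \<in> {z. z ^ N = 1}"
  define b where "b = restrict (\<lambda>x. z ^ nat x) {0..<int N}"
  have "cmod z ^ N = 1"
    using z by (simp flip: norm_power)
  then have "cmod z = 1"
    using power_eq_imp_eq_base[of "cmod z" N 1] N by simp
  moreover have "z ^ nat ((x + y) mod int N) = z ^ nat x * z ^ nat y"
    if "0 \<le> x" "0 \<le> y" for x y
  proof -
    have "z ^ (m mod N) = z ^ m" for m
    proof -
      have "z ^ m = (z ^ N) ^ (m div N) * z ^ (m mod N)"
        by (simp flip: power_mult power_add)
      with z show ?thesis by simp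
    qed
    then show ?thesis
      using that by (simp add: nat_mod_distrib nat_add_distrib power_add)
  qed
  ultimately have "b \<in> characters (integer_mod_group N)"
    using N by (auto simp: b_def characters_def hom_def circle_group_def
        carrier_integer_mod_group norm_power)
  moreover have "b 1 = z"
    using N by (simp add: b_def)
  ultimately show "z \<in> (\<lambda>b. b 1) ` characters (integer_mod_group N)" by blast
qed (use assms character_integer_mod_group_root_of_unity in auto)

text \<open>Evaluation at 1 is a bijection from the characters onto the \<open>N\<close> roots of
  unity of order dividing \<open>N\<close>.\<close>

lemma
  assumes "N \<ge> 2"
  shows finite_characters_integer_mod_group: "finite (characters (integer_mod_group N))"
    and card_characters_integer_mod_group: "card (characters (integer_mod_group N)) = N"
proof -
  have "bij_betw (\<lambda>b. b 1) (characters (integer_mod_group N)) {z. z ^ N = 1}"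
    using inj_on_characters_integer_mod_group characters_integer_mod_group_image assms
    by (simp add: bij_betw_def)
  moreover have "finite {z::complex. z ^ N = 1}" "card {z::complex. z ^ N = 1} = N"
    using assms by (auto intro!: finite_roots_unity card_roots_unity_eq)
  ultimately show "finite (characters (integer_mod_group N))"
    "card (characters (integer_mod_group N)) = N"
    by (auto simp: bij_betw_finite bij_betw_same_card)
qed

section \<open>Pigeonhole on the subgroup of even residues\<close>

text \<open>On even residues a character \<open>b\<close> takes powers of
  \<open>(b 1)\<^sup>2\<close> as values. That square is one of only \<open>q\<close> roots of
  unity, so two members of \<open>B\<close> share it.\<close>

lemma characters_agree_on_evens:
  assumes q: "q > 0" and B: "B \<subseteq> characters (integer_mod_group (2 * q))" "card B > q"
  shows "\<exists>b\<in>B. \<exists>c\<in>B. b \<noteq> c \<and>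
           (\<forall>x\<in>carrier (integer_mod_group (2 * q)). even x \<longrightarrow> b x = c x)"
proof -
  have N: "2 * q \<ge> 2" using q by simp
  have "(\<lambda>b. (b 1)\<^sup>2) ` B \<subseteq> {z. z ^ q = 1}"
    using character_integer_mod_group_root_of_unity[OF _ N] B by (auto simp flip: power_mult)
  moreover have "finite {z::complex. z ^ q = 1}" "card {z::complex. z ^ q = 1} = q"
    using q by (auto intro!: finite_roots_unity card_roots_unity_eq)
  ultimately have "card ((\<lambda>b. (b 1)\<^sup>2) ` B) \<le> q"
    by (metis card_mono)
  then have "\<not> inj_on (\<lambda>b. (b 1)\<^sup>2) B"
    using B by (intro pigeonhole) simp
  then obtain b c where bc: "b \<in> B" "c \<in> B" "b \<noteq> c" "(b 1)\<^sup>2 = (c 1)\<^sup>2"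
    by (auto simp: inj_on_def)
  have "b x = c x" if "x \<in> carrier (integer_mod_group (2 * q))" "even x" for x
  proof -
    have "0 \<le> x" "x < int (2 * q)"
      using that q by (auto simp: carrier_integer_mod_group)
    moreover obtain y where "x = 2 * y" using \<open>even x\<close> by blast
    ultimately obtain m where m: "x = int (2 * m)" "2 * m < 2 * q"
      using zero_le_imp_eq_int[of y] by auto
    have pow: "d x = ((d 1)\<^sup>2) ^ m" if "d \<in> B" for d
      using character_integer_mod_group_eq_power[OF _ N m(2)] B that m(1)
      by (auto simp: power_mult)
    show ?thesis
      using pow[OF bc(1)] pow[OF bc(2)] bc(4) by simp
  qed
  with bc(1-3) show ?thesis by blast
qed

text \<open>The set \<open>E\<close> has \<open>q + 1\<close> elements, so every competing
  \<open>B\<close> contains two characters that agree off 1. The resulting bound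
  \<open>(q + 1) / 4\<close> is rounded down to \<open>q / 4\<close>.\<close>

lemma riesz_ratio_evens_insert_1_ge:
  fixes q :: nat
  assumes q: "q > 0"
  defines "E \<equiv> insert 1 {x \<in> carrier (integer_mod_group (2 * q)). even x}"
  shows "ereal (q / 4) \<le> riesz_ratio (integer_mod_group (2 * q)) E"
proof -
  let ?G = "integer_mod_group (2 * q)"
  have N: "2 * q \<ge> 2" using q by simp
  have "{x \<in> carrier ?G. even x} = (\<lambda>m. 2 * int m) ` {..<q}"
  proof (intro equalityI subsetI)
    fix x assume "x \<in> {x \<in> carrier ?G. even x}"
    then have "0 \<le> x" "x < 2 * int q" "even x"
      using q by (auto simp: carrier_integer_mod_group)
    then have "x = 2 * int (nat (x div 2))" "nat (x div 2) < q" by auto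
    then show "x \<in> (\<lambda>m. 2 * int m) ` {..<q}" by blast
  qed (use q in \<open>auto simp: carrier_integer_mod_group\<close>)
  moreover have "card ((\<lambda>m. 2 * int m) ` {..<q}) = q"
    by (subst card_image) (auto simp: inj_on_def)
  moreover have "1 \<notin> (\<lambda>m. 2 * int m) ` {..<q}"
    by (auto dest: arg_cong[where f = even])
  ultimately have E: "finite E" "card E = Suc q"
    by (simp_all add: E_def)
  have sub: "E \<subseteq> carrier ?G"
    by (auto simp: E_def)
  define F where "F = {B. B \<subseteq> characters ?G \<and> card B = card E}"
  \<comment> \<open>The minimum is taken over a finite nonempty family: \<open>q > 0\<close> gives
    \<open>q + 1 \<le> 2 * q\<close>, so there are enough characters to choose from.\<close>
  have "finite F"
    using finite_characters_integer_mod_group[OF N] by (simp add: F_def)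
  moreover have "F \<noteq> {}"
    using obtain_subset_with_card_n[of "card E" "characters ?G"]
      card_characters_integer_mod_group[OF N] E q by (auto simp: F_def)
  moreover have "ereal (q / 4) \<le> riesz_ratio_wrt E B" if "B \<in> F" for B
  proof -
    have B: "B \<subseteq> characters ?G" "card B = card E"
      using that by (auto simp: F_def)
    have "card B > q"
      using B(2) E(2) by simp
    obtain b c where bc: "b \<in> B" "c \<in> B" "b \<noteq> c"
      and evens: "\<forall>x\<in>carrier ?G. even x \<longrightarrow> b x = c x"
      using characters_agree_on_evens[OF q B(1) \<open>card B > q\<close>] by blast
    have "finite B"
      using B(1) finite_characters_integer_mod_group[OF N] by (rule finite_subset)
    then have "ereal (card E / 4) \<le> riesz_ratio_wrt E B"
    proof (rule riesz_ratio_wrt_ge[where y = 1, OF E(1) _ B(2) _ bc])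
      show "cmod (b x) = 1" if "b \<in> B" "x \<in> E" for b x
        using that B(1) sub by (auto intro: cmod_character)
      show "b x = c x" if "x \<in> E - {1}" for x
        using that evens by (auto simp: E_def)
    qed
    moreover have "ereal (q / 4) \<le> ereal (card E / 4)"
      using E(2) by simp
    ultimately show ?thesis by (rule order_trans[rotated])
  qed
  ultimately show ?thesis
    unfolding riesz_ratio_def F_def[symmetric] by (subst Min_ge_iff) auto
qed

theorem theorem1p2:
  shows "\<exists>(G :: nat \<Rightarrow> int monoid) (E :: nat \<Rightarrow> int set).
           (\<forall>n. comm_group (G n) \<and> finite (carrier (G n)) \<and>
                E n \<subseteq> carrier (G n) \<and> E n \<noteq> {}) \<and>
           (\<lambda>n. riesz_ratio (G n) (E n)) \<longlonglongrightarrow> \<infinity>"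
proof -
  \<comment> \<open>\<open>Suc n\<close> keeps the parameter \<open>q\<close> positive, also at
    \<open>n = 0\<close>.\<close>
  define G where "G n = integer_mod_group (2 * Suc n)" for n
  define E where "E n = insert 1 {x \<in> carrier (G n). even x}" for n
  have "comm_group (G n) \<and> finite (carrier (G n)) \<and> E n \<subseteq> carrier (G n) \<and> E n \<noteq> {}" for n
    by (auto simp: G_def E_def carrier_integer_mod_group)
  moreover have "(\<lambda>n. riesz_ratio (G n) (E n)) \<longlonglongrightarrow> \<infinity>"
    unfolding Lim_PInfty
  proof (intro allI)
    fix r :: real
    \<comment> \<open>The factor 4 cancels the denominator of the lower bound.\<close>
    obtain N :: nat where "4 * r \<le> real N"
      using real_arch_simple by blast
    have "ereal r \<le> riesz_ratio (G n) (E n)" if "n \<ge> N" for n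
    proof -
      have "ereal r \<le> ereal (Suc n / 4)"
        using \<open>4 * r \<le> real N\<close> that by simp
      also have "\<dots> \<le> riesz_ratio (G n) (E n)"
        unfolding G_def E_def by (rule riesz_ratio_evens_insert_1_ge) simp
      finally show ?thesis .
    qed
    then show "\<exists>N. \<forall>n\<ge>N. ereal r \<le> riesz_ratio (G n) (E n)" by blast
  qed
  ultimately show ?thesis by blast
qed

end
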